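(* Let $G=(V,E)$ be a connected, finite, simple, undirected symmetric graph with $N=\#V\geq 2$ vertices, and let $0=\lambda_0<\lambda_1\leq\cdots\leq\lambda_{N-1}$ be all eigenvalues of its normalized Laplace operator, counted with multiplicity. Then for every integer $k$ with $0\leq k\leq N-2$, \[ \lambda_{k+1}\leq \frac{(k+1)\lambda_1+\sum_{i=1}^k\bigl((5-2\lambda_1)\lambda_i-\lambda_i^2\bigr)}{\sum_{i=0}^k(1-\lambda_i)}. \]
   Context: A graph $G=(V,E)$ is symmetric if for any two edges $(x,y),(x',y')$ (as ordered pairs of adjacent vertices) there is a graph automorphism $\gamma$ of $G$ with $\gamma x=x'$ and $\gamma y=y'$; such a graph is $d$-regular for some $d\geq1$. Write $x\sim y$ for adjacency. The normalized Laplace operator acts on functions $u:V\to\mathbb{R}$ by $\Delta u(x)=\frac1d\sum_{y\sim x}(u(y)-u(x))$; $\lambda$ is an eigenvalue if $\Delta u+\lambda u=0$ for some non-zero $u$. *)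

theory Defs
  imports "HOL-Analysis.Analysis" "Graph_Theory.Graph_Theory"
begin

text \<open>
  A finite simple undirected graph is a \<^locale>\<open>pair_graph\<close>: every undirected edge is
  represented by its two ordered pairs of endpoints. In the analytic definitions below the
  vertex set is a whole finite type \<open>'v\<close>, so that functions on the vertices are the
  vectors \<^typ>\<open>real ^ 'v\<close>.
\<close>

definition graph_automorphism :: "'v pair_pre_digraph \<Rightarrow> ('v \<Rightarrow> 'v) \<Rightarrow> bool" where
  "graph_automorphism G \<gamma> \<longleftrightarrow>
     bij_betw \<gamma> (pverts G) (pverts G) \<and>
     (\<forall>x\<in>pverts G. \<forall>y\<in>pverts G. (\<gamma> x, \<gamma> y) \<in> parcs G \<longleftrightarrow> (x, y) \<in> parcs G)"

text \<open>
  Not to be confused with the library constant \<^const>\<open>symmetric\<close>, which only says that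
  the adjacency relation is symmetric. Since the pairs are ordered, an edge can in particular be
  reversed by an automorphism.
\<close>

definition symmetric_graph :: "'v pair_pre_digraph \<Rightarrow> bool" where
  "symmetric_graph G \<longleftrightarrow>
     (\<forall>x y x' y'. (x, y) \<in> parcs G \<and> (x', y') \<in> parcs G \<longrightarrow>
        (\<exists>\<gamma>. graph_automorphism G \<gamma> \<and> \<gamma> x = x' \<and> \<gamma> y = y'))"

text \<open>
  The normalizing factor is the degree at \<open>x\<close>, which in a \<open>d\<close>-regular graph is
  the constant \<open>d\<close>.
\<close>

definition normalized_laplacian ::
    "'v::finite pair_pre_digraph \<Rightarrow> real ^ 'v \<Rightarrow> real ^ 'v" where
  "normalized_laplacian G u =
     (\<chi> x. 1 / real (out_degree (with_proj G) x) *
            (\<Sum>y | (x, y) \<in> parcs G. u $ y - u $ x))"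

text \<open>
  In the sign convention used here \<open>\<mu>\<close> is an eigenvalue iff this subspace contains a
  non-zero function; its dimension is the multiplicity of \<open>\<mu>\<close>.
\<close>

definition laplacian_eigenspace ::
    "'v::finite pair_pre_digraph \<Rightarrow> real \<Rightarrow> (real ^ 'v) set" where
  "laplacian_eigenspace G \<mu> = {u. normalized_laplacian G u + \<mu> *\<^sub>R u = 0}"

text \<open>
  \<open>lam 0 \<le> \<dots> \<le> lam (N - 1)\<close> lists all eigenvalues, each as often as its
  multiplicity; values \<open>lam i\<close> with \<open>i \<ge> N\<close> are irrelevant.
\<close>

definition laplacian_eigenvalues ::
    "'v::finite pair_pre_digraph \<Rightarrow> (nat \<Rightarrow> real) \<Rightarrow> bool" where
  "laplacian_eigenvalues G lam \<longleftrightarrow>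
     mono_on {..<card (pverts G)} lam \<and>
     (\<forall>\<mu>. card {i. i < card (pverts G) \<and> lam i = \<mu>} = dim (laplacian_eigenspace G \<mu>))"

end

theory Submission
  imports Defs
begin

text \<open>
  Let \<open>f\<close> be an eigenfunction for \<open>\<lambda>\<^sub>1\<close>. Since automorphisms act transitively on ordered
  edges, the translates \<open>f \<circ> \<gamma>\<close> form a spherical family: \<open>\<Sum>\<^sub>\<gamma> f(\<gamma>x)\<^sup>2\<close> is a constant
  \<open>c\<close>, and \<open>\<Sum>\<^sub>\<gamma> f(\<gamma>x) f(\<gamma>y) = c (1 - \<lambda>\<^sub>1)\<close> on edges. Let \<open>u\<^sub>i\<close> be an orthonormal eigenbasis
  and \<open>\<beta>\<^sub>i\<^sub>j\<close> the sum over \<open>\<gamma>\<close> of the squared matrix entries of multiplication by \<open>f \<circ> \<gamma>\<close>.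
  Expanding the commutators of these multiplications with the Laplacian gives
  \<open>\<Sum>\<^sub>j (\<lambda>\<^sub>j - \<lambda>\<^sub>i) \<beta>\<^sub>i\<^sub>j = c \<lambda>\<^sub>1 (1 - \<lambda>\<^sub>i)\<close> and
  \<open>\<Sum>\<^sub>j (\<lambda>\<^sub>j - \<lambda>\<^sub>i)\<^sup>2 \<beta>\<^sub>i\<^sub>j \<le> c \<lambda>\<^sub>1 (\<lambda>\<^sub>1 + (4 - 2\<lambda>\<^sub>1) \<lambda>\<^sub>i)\<close>.
  Since \<open>\<beta>\<close> is symmetric, antisymmetry turns this into the Yang-type inequality
  \<open>\<Sum>\<^sub>i (z - \<lambda>\<^sub>i)\<^sup>2 (1 - \<lambda>\<^sub>i) \<le> \<Sum>\<^sub>i (z - \<lambda>\<^sub>i) (\<lambda>\<^sub>1 + (4 - 2\<lambda>\<^sub>1) \<lambda>\<^sub>i)\<close> over \<open>i \<le> k\<close>,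
  where \<open>z = \<lambda>\<^sub>k\<^sub>+\<^sub>1\<close>. The difference of the two sides is \<open>\<Sum>\<^sub>i (z - \<lambda>\<^sub>i) q(\<lambda>\<^sub>i)\<close> with \<open>q\<close> a convex quadratic
  satisfying \<open>q(z) < 0\<close>, and a Chebyshev argument removes the weight \<open>z - \<lambda>\<^sub>i\<close>.
\<close>

section \<open>Inequalities for finite sequences\<close>

lemma antisymmetric_double_sum:
  fixes h :: "'a \<Rightarrow> 'a \<Rightarrow> real"
  assumes "\<And>i j. i \<in> A \<Longrightarrow> j \<in> A \<Longrightarrow> h i j = - h j i"
  shows "(\<Sum>i\<in>A. \<Sum>j\<in>A. h i j) = 0"
proof -
  have "(\<Sum>i\<in>A. \<Sum>j\<in>A. h i j) = (\<Sum>i\<in>A. \<Sum>j\<in>A. - h j i)"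
    by (intro sum.cong refl assms)
  also have "\<dots> = - (\<Sum>i\<in>A. \<Sum>j\<in>A. h i j)"
    by (subst sum.swap) (simp add: sum_negf)
  finally show ?thesis by simp
qed

text \<open>
  On \<open>t \<le> z\<close> the convex \<open>q\<close> changes sign at most once, from positive to negative, say at \<open>T\<close>.
  Since \<open>z - t\<close> decreases, the weighted sum is at least \<open>z - T\<close> times the unweighted one.
\<close>

lemma sum_nonpos_if_weighted_sum_nonpos:
  fixes z a b :: real and \<xi> :: "'i \<Rightarrow> real"
  defines "q \<equiv> \<lambda>t. t\<^sup>2 + a * t + b"
  assumes "finite A" and le: "\<And>i. i \<in> A \<Longrightarrow> \<xi> i \<le> z" and qz: "q z < 0"
    and weighted: "(\<Sum>i\<in>A. (z - \<xi> i) * q (\<xi> i)) \<le> 0"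
  shows "(\<Sum>i\<in>A. q (\<xi> i)) \<le> 0"
proof (rule ccontr)
  assume "\<not> ?thesis"
  then have pos: "(\<Sum>i\<in>A. q (\<xi> i)) > 0" by simp
  define P where "P = {i \<in> A. q (\<xi> i) > 0}"
  \<comment> \<open>The largest sample with \<open>q\<close> positive stands in for the root: beyond
    it all samples have \<open>q\<close> \<le> 0.\<close>
  define T where "T = Max (\<xi> ` P)"
  have "P \<noteq> {}"
    using pos sum_nonpos[of A "\<lambda>i. q (\<xi> i)"] unfolding P_def by force
  then have "T \<in> \<xi> ` P"
    unfolding T_def using \<open>finite A\<close> by (intro Max_in) (auto simp: P_def)
  then have qT: "q T > 0" and "T \<le> z" using le by (auto simp: P_def)
  with qz have "T < z" by (cases "T = z") auto
  have "(z - T) * q (\<xi> i) \<le> (z - \<xi> i) * q (\<xi> i)" if "i \<in> A" for i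
  proof (cases "\<xi> i \<le> T")
    case True
    \<comment> \<open>Linear interpolation of \<open>q\<close> between \<open>T\<close> and
      \<open>z\<close>; the remainder is exact because \<open>q\<close> has leading coefficient
      1.\<close>
    have "(z - T) * q (\<xi> i) =
        (z - \<xi> i) * q T - (T - \<xi> i) * q z + (z - T) * (T - \<xi> i) * (z - \<xi> i)"
      unfolding q_def by (simp add: algebra_simps power2_eq_square)
    moreover have "(z - \<xi> i) * q T \<ge> 0" "(T - \<xi> i) * q z \<le> 0"
        "(z - T) * (T - \<xi> i) * (z - \<xi> i) \<ge> 0"
      using qT qz \<open>T < z\<close> True by (simp_all add: mult_nonneg_nonpos)
    ultimately have "(z - T) * q (\<xi> i) \<ge> 0" by linarith
    then have "q (\<xi> i) \<ge> 0" using \<open>T < z\<close> by (simp add: zero_le_mult_iff)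
    with True show ?thesis by (intro mult_right_mono) auto
  next
    case False
    have "i \<notin> P"
      using False \<open>finite A\<close> Max_ge[of "\<xi> ` P" "\<xi> i"] unfolding T_def P_def by auto
    then have "q (\<xi> i) \<le> 0" using that by (auto simp: P_def)
    with False show ?thesis by (intro mult_right_mono_neg) auto
  qed
  then have "(z - T) * (\<Sum>i\<in>A. q (\<xi> i)) \<le> (\<Sum>i\<in>A. (z - \<xi> i) * q (\<xi> i))"
    unfolding sum_distrib_left by (rule sum_mono)
  with weighted pos \<open>T < z\<close> show False
    by (smt (verit) mult_pos_pos)
qed

text \<open>What is kept of the graph is a symmetric nonnegative weight \<open>\<beta>\<close> with
  information on two moments of the gaps; \<open>m\<close> will be \<open>c * \<mu>\<close>.\<close>

lemma prefix_eigenvalue_inequality: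
  fixes lam :: "nat \<Rightarrow> real" and \<beta> :: "nat \<Rightarrow> nat \<Rightarrow> real" and \<mu> m :: real
  assumes mono: "mono_on {..<N} lam"
    and lam0: "lam 0 = 0"
    and \<mu>: "0 < \<mu>" "\<mu> \<le> 2" and m: "m > 0"
    and sym: "\<And>i j. \<beta> i j = \<beta> j i" and nonneg: "\<And>i j. \<beta> i j \<ge> 0"
    and first: "\<And>i. i < N \<Longrightarrow> (\<Sum>j<N. (lam j - lam i) * \<beta> i j) = m * (1 - lam i)"
    and second: "\<And>i. i < N \<Longrightarrow>
      (\<Sum>j<N. (lam j - lam i)\<^sup>2 * \<beta> i j) \<le> m * (\<mu> + (4 - 2 * \<mu>) * lam i)"
    and k: "k + 1 < N"
  shows "lam (k + 1) \<le> (real (k + 1) * \<mu> + (\<Sum>i=1..k. (5 - 2 * \<mu>) * lam i - (lam i)\<^sup>2))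
    / (\<Sum>i=0..k. 1 - lam i)"
proof -
  have le: "lam i \<le> lam j" if "i \<le> j" "j < N" for i j
    using mono_onD[OF mono, of i j] that by simp
  have split: "(\<Sum>j<N. h j) = (\<Sum>j\<le>n. h j) + (\<Sum>j=Suc n..<N. h j)" if "n < N"
    for h :: "nat \<Rightarrow> real" and n
  proof -
    have "{..<N} = {..n} \<union> {Suc n..<N}" using that by auto
    show ?thesis unfolding \<open>{..<N} = _\<close> by (rule sum.union_disjoint) auto
  qed
  \<comment> \<open>Summing \<open>first\<close> over a prefix cancels the pairs inside it; the
    remaining pairs have \<open>i \<le> n < j\<close>, so their gaps are nonnegative.\<close>
  have prefix_nonneg: "(\<Sum>i\<le>n. 1 - lam i) \<ge> 0" if "n < N" for n
  proof -
    have "m * (\<Sum>i\<le>n. 1 - lam i) = (\<Sum>i\<le>n. \<Sum>j<N. (lam j - lam i) * \<beta> i j)"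
      using that first by (simp add: sum_distrib_left)
    also have "\<dots> = (\<Sum>i\<le>n. \<Sum>j\<le>n. (lam j - lam i) * \<beta> i j)
        + (\<Sum>i\<le>n. \<Sum>j=Suc n..<N. (lam j - lam i) * \<beta> i j)"
      by (simp only: split[OF that] sum.distrib)
    also have "(\<Sum>i\<le>n. \<Sum>j\<le>n. (lam j - lam i) * \<beta> i j) = 0"
      by (rule antisymmetric_double_sum) (subst sym, simp add: algebra_simps)
    finally have "m * (\<Sum>i\<le>n. 1 - lam i) =
        (\<Sum>i\<le>n. \<Sum>j=Suc n..<N. (lam j - lam i) * \<beta> i j)" by simp
    moreover have "(\<Sum>i\<le>n. \<Sum>j=Suc n..<N. (lam j - lam i) * \<beta> i j) \<ge> 0"
      by (auto intro!: sum_nonneg mult_nonneg_nonneg simp: le nonneg)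
    ultimately have "m * (\<Sum>i\<le>n. 1 - lam i) \<ge> 0" by (simp only:)
    then show ?thesis using m by (auto simp only: zero_le_mult_iff)
  qed
  \<comment> \<open>If the sum vanished, then \<open>lam k > 1\<close> and the next prefix sum would be negative.\<close>
  have D: "(\<Sum>i\<le>k. 1 - lam i) > 0"
  proof (rule ccontr)
    assume "\<not> ?thesis"
    then have zero: "(\<Sum>i\<le>k. 1 - lam i) = 0" using prefix_nonneg[of k] k by simp
    have "lam k > 1"
    proof (rule ccontr)
      assume "\<not> lam k > 1"
      then have "1 - lam i \<ge> 0" if "i \<le> k" for i using le[of i k] that k by simp
      then have "(\<Sum>i\<le>k. 1 - lam i) \<ge> 1 - lam 0"
        by (intro member_le_sum) auto
      with zero lam0 show False by simp
    qed
    then have "(\<Sum>i\<le>Suc k. 1 - lam i) < 0" using zero le[of k "Suc k"] k by simp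
    with prefix_nonneg[of "Suc k"] k show False by simp
  qed
  define z where "z = lam (k + 1)"
  \<comment> \<open>Chosen so that a nonpositive sum of \<open>q (lam i)\<close> over
    \<open>i \<le> k\<close> is the claim with its denominator cleared.\<close>
  define q where "q = (\<lambda>t. t\<^sup>2 + (2 * \<mu> - 5 - z) * t + (z - \<mu>))"
  have q_alt: "q t = (z - t) * (1 - t) - (\<mu> + (4 - 2 * \<mu>) * t)" for t
    unfolding q_def by (simp add: algebra_simps power2_eq_square)
  have z0: "z \<ge> 0" using le[of 0 "k + 1"] k lam0 by (simp add: z_def)
  have lez: "lam i \<le> z" if "i \<le> k" for i using le[of i "k + 1"] that k by (simp add: z_def)
  \<comment> \<open>With weight \<open>(z - lam i)\<^sup>2\<close> on \<open>first\<close> and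
    \<open>z - lam i\<close> on \<open>second\<close>, the difference has terms antisymmetric in
    \<open>i\<close> and \<open>j\<close>.\<close>
  have "m * (\<Sum>i\<le>k. (z - lam i) * q (lam i)) \<le>
      (\<Sum>i\<le>k. \<Sum>j<N. (z - lam i) * (lam j - lam i) * (z - lam j) * \<beta> i j)"
    unfolding sum_distrib_left[of m]
  proof (rule sum_mono)
    fix i assume "i \<in> {..k}"
    then have i: "i \<le> k" "i < N" using k by auto
    have "m * ((z - lam i) * q (lam i)) = (z - lam i) *
        ((z - lam i) * (m * (1 - lam i)) - m * (\<mu> + (4 - 2 * \<mu>) * lam i))"
      unfolding q_alt by (simp add: algebra_simps)
    also have "\<dots> \<le> (z - lam i) * ((z - lam i) * (\<Sum>j<N. (lam j - lam i) * \<beta> i j)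
        - (\<Sum>j<N. (lam j - lam i)\<^sup>2 * \<beta> i j))"
      unfolding first[OF i(2)] using second[OF i(2)] lez[OF i(1)]
      by (intro mult_left_mono) auto
    also have "\<dots> = (\<Sum>j<N. (z - lam i) * (lam j - lam i) * (z - lam j) * \<beta> i j)"
      by (simp add: sum_distrib_left algebra_simps power2_eq_square flip: sum_subtractf)
    finally show "m * ((z - lam i) * q (lam i)) \<le>
        (\<Sum>j<N. (z - lam i) * (lam j - lam i) * (z - lam j) * \<beta> i j)" .
  qed
  also have "\<dots> = (\<Sum>i\<le>k. \<Sum>j\<le>k. (z - lam i) * (lam j - lam i) * (z - lam j) * \<beta> i j)
      + (\<Sum>i\<le>k. \<Sum>j=Suc k..<N. (z - lam i) * (lam j - lam i) * (z - lam j) * \<beta> i j)"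
    using k by (simp only: split[of k] sum.distrib add_lessD1)
  also have "(\<Sum>i\<le>k. \<Sum>j\<le>k. (z - lam i) * (lam j - lam i) * (z - lam j) * \<beta> i j) = 0"
    by (rule antisymmetric_double_sum) (subst sym, simp add: algebra_simps)
  also have "0 + (\<Sum>i\<le>k. \<Sum>j=Suc k..<N. (z - lam i) * (lam j - lam i) * (z - lam j) * \<beta> i j) \<le> 0"
  proof -
    \<comment> \<open>As \<open>z\<close> lies between \<open>lam i\<close> and
      \<open>lam j\<close>, only the factor \<open>z - lam j\<close> can be negative.\<close>
    have "(z - lam i) * (lam j - lam i) * (z - lam j) * \<beta> i j \<le> 0"
      if "i \<le> k" "Suc k \<le> j" "j < N" for i j
      using lez[OF that(1)] le[of i j] le[of "k + 1" j] that nonneg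
      by (intro mult_nonpos_nonneg mult_nonneg_nonpos mult_nonneg_nonneg) (auto simp: z_def)
    then show ?thesis by (auto intro!: sum_nonpos)
  qed
  finally have "(\<Sum>i\<le>k. (z - lam i) * q (lam i)) \<le> 0"
    using m by (simp add: mult_le_0_iff)
  moreover have "q z < 0"
  proof -
    have "(4 - 2 * \<mu>) * z \<ge> 0" using \<mu> z0 by simp
    then show ?thesis using \<mu> by (simp add: q_alt)
  qed
  ultimately have "(\<Sum>i\<le>k. q (lam i)) \<le> 0"
    unfolding q_def by (intro sum_nonpos_if_weighted_sum_nonpos[of _ _ z]) (use lez in auto)
  also have "(\<Sum>i\<le>k. q (lam i)) =
      (\<Sum>i\<le>k. z * (1 - lam i) - \<mu> - ((5 - 2 * \<mu>) * lam i - (lam i)\<^sup>2))"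
    by (rule sum.cong) (simp_all add: q_def algebra_simps)
  also have "\<dots> = z * (\<Sum>i\<le>k. 1 - lam i) - real (k + 1) * \<mu>
      - (\<Sum>i\<le>k. (5 - 2 * \<mu>) * lam i - (lam i)\<^sup>2)"
    by (simp add: sum_subtractf sum_distrib_left right_diff_distrib)
  \<comment> \<open>The term at index 0 vanishes because \<open>lam 0 = 0\<close>.\<close>
  also have "(\<Sum>i\<le>k. (5 - 2 * \<mu>) * lam i - (lam i)\<^sup>2) =
      (\<Sum>i=1..k. (5 - 2 * \<mu>) * lam i - (lam i)\<^sup>2)"
    by (simp add: atMost_atLeast0 sum.atLeast_Suc_atMost[of 0] lam0)
  finally show ?thesis
    using D by (simp add: z_def pos_le_divide_eq atMost_atLeast0)
qed

section \<open>Commutators with the Laplacian of a symmetric kernel\<close>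

locale symmetric_stochastic_kernel =
  fixes p :: "'v::finite \<Rightarrow> 'v \<Rightarrow> real"
  assumes sym: "p x y = p y x"
    and nonneg: "p x y \<ge> 0"
    and sum_one: "(\<Sum>y\<in>UNIV. p x y) = 1"
begin

text \<open>The operator \<open>I - P\<close>, the negative of the Laplacian in the theorem, so that
  its eigenvalues are nonnegative.\<close>

definition lap :: "('v \<Rightarrow> real) \<Rightarrow> 'v \<Rightarrow> real" where
  "lap u x = (\<Sum>y\<in>UNIV. p x y * (u x - u y))"

lemma lap_alt: "lap u x = u x - (\<Sum>y\<in>UNIV. p x y * u y)"
  by (simp add: lap_def right_diff_distrib sum_subtractf sum_one flip: sum_distrib_right)

lemma sum_kernel_left: "(\<Sum>x\<in>UNIV. \<Sum>y\<in>UNIV. p x y * g x) = (\<Sum>x\<in>UNIV. g x)"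
  by (simp add: sum_one flip: sum_distrib_right)

lemma sum_kernel_right: "(\<Sum>x\<in>UNIV. \<Sum>y\<in>UNIV. p x y * g y) = (\<Sum>x\<in>UNIV. g x)"
proof -
  have "(\<Sum>x\<in>UNIV. \<Sum>y\<in>UNIV. p x y * g y) = (\<Sum>y\<in>UNIV. \<Sum>x\<in>UNIV. p y x * g y)"
    by (subst sum.swap) (simp add: sym)
  then show ?thesis by (simp only: sum_kernel_left)
qed

lemma lap_self_adjoint: "(\<Sum>x\<in>UNIV. lap u x * v x) = (\<Sum>x\<in>UNIV. u x * lap v x)"
proof -
  have "(\<Sum>x\<in>UNIV. \<Sum>y\<in>UNIV. p x y * u y * v x) = (\<Sum>y\<in>UNIV. \<Sum>x\<in>UNIV. p y x * u y * v x)"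
    by (subst sum.swap) (simp add: sym)
  then show ?thesis
    by (simp add: lap_alt left_diff_distrib right_diff_distrib sum_subtractf
        sum_distrib_left sum_distrib_right mult_ac)
qed

text \<open>Expanding the square uses both marginals of \<open>p\<close>. The sum runs over ordered
  pairs, hence the factor 2.\<close>

lemma dirichlet_form:
  "(\<Sum>x\<in>UNIV. \<Sum>y\<in>UNIV. p x y * (u x - u y)\<^sup>2) = 2 * (\<Sum>x\<in>UNIV. u x * lap u x)"
proof -
  have "(\<Sum>x\<in>UNIV. \<Sum>y\<in>UNIV. p x y * (u x - u y)\<^sup>2) =
      (\<Sum>x\<in>UNIV. \<Sum>y\<in>UNIV. p x y * (u x)\<^sup>2) + (\<Sum>x\<in>UNIV. \<Sum>y\<in>UNIV. p x y * (u y)\<^sup>2)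
      - 2 * (\<Sum>x\<in>UNIV. \<Sum>y\<in>UNIV. p x y * u x * u y)"
    by (simp add: power2_diff algebra_simps sum.distrib sum_subtractf sum_distrib_left)
  also have "\<dots> = 2 * (\<Sum>x\<in>UNIV. (u x)\<^sup>2) - 2 * (\<Sum>x\<in>UNIV. \<Sum>y\<in>UNIV. p x y * u x * u y)"
    by (simp only: sum_kernel_left sum_kernel_right)
  also have "\<dots> = 2 * (\<Sum>x\<in>UNIV. u x * lap u x)"
    by (simp add: lap_alt right_diff_distrib sum_subtractf sum_distrib_left
        power2_eq_square mult_ac)
  finally show ?thesis .
qed

text \<open>The Dirichlet form gives the lower bound. Its counterpart with \<open>u x + u y\<close>
  equals \<open>2 * (2 - \<mu>)\<close> times the squared norm, which gives the upper one.\<close>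

lemma eigenvalue_bounds:
  assumes eig: "\<And>x. lap u x = \<mu> * u x" and nz: "(\<Sum>x\<in>UNIV. (u x)\<^sup>2) > 0"
  shows "0 \<le> \<mu>" "\<mu> \<le> 2"
proof -
  let ?S = "\<Sum>x\<in>UNIV. (u x)\<^sup>2"
  have D: "(\<Sum>x\<in>UNIV. \<Sum>y\<in>UNIV. p x y * (u x - u y)\<^sup>2) = 2 * (\<mu> * ?S)"
    unfolding dirichlet_form eig by (simp add: sum_distrib_left power2_eq_square mult_ac)
  have "(\<Sum>x\<in>UNIV. \<Sum>y\<in>UNIV. p x y * (u x - u y)\<^sup>2) \<ge> 0"
    by (intro sum_nonneg mult_nonneg_nonneg nonneg) auto
  with D nz show "0 \<le> \<mu>" by (simp add: zero_le_mult_iff)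
  have "(\<Sum>x\<in>UNIV. \<Sum>y\<in>UNIV. p x y * (u x + u y)\<^sup>2) +
      (\<Sum>x\<in>UNIV. \<Sum>y\<in>UNIV. p x y * (u x - u y)\<^sup>2) =
      2 * (\<Sum>x\<in>UNIV. \<Sum>y\<in>UNIV. p x y * (u x)\<^sup>2) + 2 * (\<Sum>x\<in>UNIV. \<Sum>y\<in>UNIV. p x y * (u y)\<^sup>2)"
    by (simp add: sum_distrib_left power2_eq_square algebra_simps flip: sum.distrib)
  also have "\<dots> = 4 * ?S"
    by (simp only: sum_kernel_left sum_kernel_right)
  finally have "(\<Sum>x\<in>UNIV. \<Sum>y\<in>UNIV. p x y * (u x + u y)\<^sup>2) = 2 * ((2 - \<mu>) * ?S)"
    using D by (simp add: algebra_simps)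
  moreover have "(\<Sum>x\<in>UNIV. \<Sum>y\<in>UNIV. p x y * (u x + u y)\<^sup>2) \<ge> 0"
    by (intro sum_nonneg mult_nonneg_nonneg nonneg) auto
  ultimately show "\<mu> \<le> 2" using nz by (simp add: zero_le_mult_iff)
qed

text \<open>The variance of \<open>t\<close> under the probability weights \<open>p x\<close> is
  nonnegative.\<close>

lemma kernel_jensen: "(\<Sum>y\<in>UNIV. p x y * t y)\<^sup>2 \<le> (\<Sum>y\<in>UNIV. p x y * (t y)\<^sup>2)"
proof -
  define m where "m = (\<Sum>y\<in>UNIV. p x y * t y)"
  have "0 \<le> (\<Sum>y\<in>UNIV. p x y * (t y - m)\<^sup>2)"
    by (intro sum_nonneg mult_nonneg_nonneg nonneg) auto
  also have "\<dots> = (\<Sum>y\<in>UNIV. p x y * (t y)\<^sup>2) - 2 * m * (\<Sum>y\<in>UNIV. p x y * t y)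
      + (\<Sum>y\<in>UNIV. p x y) * m\<^sup>2"
    by (simp add: power2_diff algebra_simps sum.distrib sum_subtractf sum_distrib_left
        sum_distrib_right)
  finally show ?thesis
    by (simp add: sum_one m_def[symmetric] power2_eq_square)
qed

end

section \<open>Spherical families of eigenfunctions and their commutators\<close>

text \<open>For \<open>c > 0\<close> the vectors with entries \<open>f g x\<close>, indexed by
  \<open>g\<close>, lie on a sphere, and those of adjacent vertices enclose a common angle with
  cosine \<open>1 - \<mu>\<close>.\<close>

locale spherical_eigenfunctions = symmetric_stochastic_kernel p
  for p :: "'v::finite \<Rightarrow> 'v \<Rightarrow> real" +
  fixes I :: "'g set" and f :: "'g \<Rightarrow> 'v \<Rightarrow> real" and \<mu> c :: real
  assumes lap_f: "g \<in> I \<Longrightarrow> lap (f g) x = \<mu> * f g x"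
    and sum_sq: "(\<Sum>g\<in>I. (f g x)\<^sup>2) = c"
    and sum_adj: "p x y \<noteq> 0 \<Longrightarrow> (\<Sum>g\<in>I. f g x * f g y) = c * (1 - \<mu>)"
begin

text \<open>The commutator of \<open>lap\<close> with multiplication by \<open>f g\<close>, applied
  to \<open>u\<close>.\<close>

definition comm :: "'g \<Rightarrow> ('v \<Rightarrow> real) \<Rightarrow> 'v \<Rightarrow> real" where
  "comm g u x = lap (\<lambda>y. f g y * u y) x - f g x * lap u x"

text \<open>Discrete product rule: the sum is the cross term of first differences, and
  \<open>lap (f g)\<close> contributes the rest.\<close>

lemma comm_alt:
  assumes "g \<in> I"
  shows "comm g u x = (\<Sum>y\<in>UNIV. p x y * ((f g x - f g y) * (u y - u x))) + \<mu> * f g x * u x"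
proof -
  have "comm g u x - lap (f g) x * u x = (\<Sum>y\<in>UNIV. p x y * ((f g x - f g y) * (u y - u x)))"
    unfolding comm_def lap_def
    by (simp add: sum_distrib_left sum_distrib_right algebra_simps flip: sum_subtractf)
  with assms show ?thesis by (simp add: lap_f)
qed

text \<open>Summing over \<open>g\<close> first replaces the products of values of \<open>f\<close>
  by \<open>c\<close> and \<open>c * (1 - \<mu>)\<close>; the identity then holds at each vertex,
  with \<open>(u x)\<^sup>2\<close> as a factor.\<close>

lemma sum_comm_inner:
  assumes eig: "\<And>x. lap u x = \<nu> * u x" and unit: "(\<Sum>x\<in>UNIV. (u x)\<^sup>2) = 1"
  shows "(\<Sum>g\<in>I. \<Sum>x\<in>UNIV. comm g u x * (f g x * u x)) = c * \<mu> * (1 - \<nu>)"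
proof -
  \<comment> \<open>With the weight \<open>p x y\<close> the edge condition becomes an identity for
    all pairs.\<close>
  have adj: "p x y * (\<Sum>g\<in>I. f g x * f g y) = p x y * (c * (1 - \<mu>))" for x y
    by (cases "p x y = 0") (simp_all add: sum_adj)
  have "(\<Sum>g\<in>I. \<Sum>x\<in>UNIV. comm g u x * (f g x * u x)) =
      (\<Sum>x\<in>UNIV. \<Sum>g\<in>I. comm g u x * (f g x * u x))"
    by (rule sum.swap)
  also have "\<dots> = (\<Sum>x\<in>UNIV. c * \<mu> * (1 - \<nu>) * (u x)\<^sup>2)"
  proof (rule sum.cong[OF refl])
    fix x
    have "(\<Sum>g\<in>I. comm g u x * (f g x * u x)) = (\<Sum>g\<in>I. (f g x)\<^sup>2) * ((1 - \<nu>) * (u x)\<^sup>2)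
        - (\<Sum>g\<in>I. \<Sum>y\<in>UNIV. p x y * (f g x * f g y) * (u x * u y))"
      unfolding comm_def eig
      by (simp add: lap_alt sum_distrib_left sum_distrib_right algebra_simps power2_eq_square
          sum_subtractf sum.distrib)
    also have "(\<Sum>g\<in>I. \<Sum>y\<in>UNIV. p x y * (f g x * f g y) * (u x * u y)) =
        (\<Sum>y\<in>UNIV. p x y * (\<Sum>g\<in>I. f g x * f g y) * (u x * u y))"
      by (subst sum.swap) (simp add: sum_distrib_left sum_distrib_right)
    also have "\<dots> = c * (1 - \<mu>) * u x * (\<Sum>y\<in>UNIV. p x y * u y)"
      unfolding adj by (simp add: sum_distrib_left mult_ac)
    also have "(\<Sum>y\<in>UNIV. p x y * u y) = (1 - \<nu>) * u x"
      using lap_alt[of u x] eig[of x] by (simp add: algebra_simps)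
    finally show "(\<Sum>g\<in>I. comm g u x * (f g x * u x)) = c * \<mu> * (1 - \<nu>) * (u x)\<^sup>2"
      unfolding sum_sq by (simp add: algebra_simps power2_eq_square)
  qed
  also have "\<dots> = c * \<mu> * (1 - \<nu>)"
    by (simp add: unit flip: sum_distrib_left)
  finally show ?thesis .
qed

text \<open>The square of \<open>comm_alt\<close> has three parts. Jensen bounds the squared
  difference part, the only loss; sphericity evaluates the other two exactly.\<close>

lemma sum_comm_norm_le:
  assumes eig: "\<And>x. lap u x = \<nu> * u x" and unit: "(\<Sum>x\<in>UNIV. (u x)\<^sup>2) = 1"
  shows "(\<Sum>g\<in>I. \<Sum>x\<in>UNIV. (comm g u x)\<^sup>2) \<le> c * \<mu> * (\<mu> + (4 - 2 * \<mu>) * \<nu>)"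
proof -
  have diff: "p x y * (\<Sum>g\<in>I. (f g x - f g y)\<^sup>2) = p x y * (2 * c * \<mu>)" for x y
  proof (cases "p x y = 0")
    case False
    have "(\<Sum>g\<in>I. (f g x - f g y)\<^sup>2) =
        (\<Sum>g\<in>I. (f g x)\<^sup>2) + (\<Sum>g\<in>I. (f g y)\<^sup>2) - 2 * (\<Sum>g\<in>I. f g x * f g y)"
      by (simp add: power2_diff sum.distrib sum_subtractf sum_distrib_left mult_ac)
    then show ?thesis using sum_adj[OF False] by (simp add: sum_sq algebra_simps)
  qed simp
  have adj: "p x y * (\<Sum>g\<in>I. f g x * (f g x - f g y)) = p x y * (c * \<mu>)" for x y
  proof (cases "p x y = 0")
    case False
    have "(\<Sum>g\<in>I. f g x * (f g x - f g y)) = (\<Sum>g\<in>I. (f g x)\<^sup>2) - (\<Sum>g\<in>I. f g x * f g y)"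
      by (simp add: sum_subtractf right_diff_distrib power2_eq_square)
    then show ?thesis using sum_adj[OF False] by (simp add: sum_sq algebra_simps)
  qed simp
  define A where "A = (\<lambda>g x. \<Sum>y\<in>UNIV. p x y * ((f g x - f g y) * (u y - u x)))"
  define D where "D = (\<lambda>x. \<Sum>y\<in>UNIV. p x y * (u x - u y)\<^sup>2)"
  have sum_D: "(\<Sum>x\<in>UNIV. D x) = 2 * (\<nu> * (\<Sum>x\<in>UNIV. (u x)\<^sup>2))"
    unfolding D_def dirichlet_form eig by (simp add: sum_distrib_left power2_eq_square mult_ac)
  have "(\<Sum>g\<in>I. \<Sum>x\<in>UNIV. (comm g u x)\<^sup>2) = (\<Sum>x\<in>UNIV. \<Sum>g\<in>I. (comm g u x)\<^sup>2)"
    by (rule sum.swap)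
  also have "\<dots> \<le> (\<Sum>x\<in>UNIV. 2 * c * \<mu> * D x
      + c * \<mu> * (\<mu> - 2 * \<mu> * \<nu>) * (u x)\<^sup>2)"
  proof (rule sum_mono)
    fix x
    have "(\<Sum>g\<in>I. (comm g u x)\<^sup>2) =
        (\<Sum>g\<in>I. (A g x)\<^sup>2) + 2 * \<mu> * u x * (\<Sum>g\<in>I. f g x * A g x)
        + \<mu>\<^sup>2 * (u x)\<^sup>2 * (\<Sum>g\<in>I. (f g x)\<^sup>2)"
    proof -
      have "(\<Sum>g\<in>I. (comm g u x)\<^sup>2) = (\<Sum>g\<in>I. (A g x + \<mu> * f g x * u x)\<^sup>2)"
        by (rule sum.cong) (simp_all add: comm_alt A_def)
      also have "\<dots> = (\<Sum>g\<in>I. (A g x)\<^sup>2 + 2 * \<mu> * u x * (f g x * A g x)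
          + \<mu>\<^sup>2 * (u x)\<^sup>2 * (f g x)\<^sup>2)"
        by (rule sum.cong) (simp_all add: power2_sum power_mult_distrib mult_ac)
      finally show ?thesis
        by (simp only: sum.distrib sum_distrib_left)
    qed
    moreover have "(\<Sum>g\<in>I. (A g x)\<^sup>2) \<le> 2 * c * \<mu> * D x"
    proof -
      have "(\<Sum>g\<in>I. (A g x)\<^sup>2) \<le>
          (\<Sum>g\<in>I. \<Sum>y\<in>UNIV. p x y * ((f g x - f g y) * (u y - u x))\<^sup>2)"
        unfolding A_def by (intro sum_mono kernel_jensen)
      also have "\<dots> = (\<Sum>y\<in>UNIV. (p x y * (\<Sum>g\<in>I. (f g x - f g y)\<^sup>2)) * (u x - u y)\<^sup>2)"
        by (subst sum.swap)
          (simp add: sum_distrib_left sum_distrib_right power_mult_distrib mult_ac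
            power2_commute[of "u x"])
      also have "\<dots> = 2 * c * \<mu> * D x"
        unfolding diff D_def by (simp add: sum_distrib_left mult_ac)
      finally show ?thesis .
    qed
    moreover have "(\<Sum>g\<in>I. f g x * A g x) = - (c * \<mu> * \<nu> * u x)"
    proof -
      have "(\<Sum>g\<in>I. f g x * A g x) =
          (\<Sum>g\<in>I. \<Sum>y\<in>UNIV. p x y * (f g x * (f g x - f g y)) * (u y - u x))"
        by (simp add: A_def sum_distrib_left mult_ac)
      also have "\<dots> = (\<Sum>y\<in>UNIV. (p x y * (\<Sum>g\<in>I. f g x * (f g x - f g y))) * (u y - u x))"
        by (subst sum.swap) (simp add: sum_distrib_left sum_distrib_right)
      also have "\<dots> = - (c * \<mu> * lap u x)"
        unfolding adj lap_def
        by (simp add: sum_distrib_left algebra_simps flip: sum_negf)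
      finally show ?thesis by (simp add: eig)
    qed
    ultimately show "(\<Sum>g\<in>I. (comm g u x)\<^sup>2) \<le> 2 * c * \<mu> * D x
      + c * \<mu> * (\<mu> - 2 * \<mu> * \<nu>) * (u x)\<^sup>2"
      unfolding sum_sq by (simp add: algebra_simps power2_eq_square)
  qed
  also have "\<dots> = 2 * c * \<mu> * (\<Sum>x\<in>UNIV. D x)
      + c * \<mu> * (\<mu> - 2 * \<mu> * \<nu>) * (\<Sum>x\<in>UNIV. (u x)\<^sup>2)"
    by (simp only: sum.distrib sum_distrib_left)
  also have "\<dots> = c * \<mu> * (\<mu> + (4 - 2 * \<mu>) * \<nu>)"
    unfolding sum_D unit by (simp add: algebra_simps)
  finally show ?thesis .
qed

text \<open>Self-adjointness moves \<open>lap\<close> onto \<open>v\<close>, where it becomes the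
  factor \<open>\<rho>\<close>.\<close>

lemma comm_coefficient:
  assumes u: "\<And>x. lap u x = \<nu> * u x" and v: "\<And>x. lap v x = \<rho> * v x"
  shows "(\<Sum>x\<in>UNIV. comm g u x * v x) = (\<rho> - \<nu>) * (\<Sum>x\<in>UNIV. f g x * u x * v x)"
proof -
  have "(\<Sum>x\<in>UNIV. comm g u x * v x) =
      (\<Sum>x\<in>UNIV. lap (\<lambda>y. f g y * u y) x * v x) - \<nu> * (\<Sum>x\<in>UNIV. f g x * u x * v x)"
    by (simp add: comm_def u algebra_simps sum_subtractf sum_distrib_left)
  also have "(\<Sum>x\<in>UNIV. lap (\<lambda>y. f g y * u y) x * v x) = \<rho> * (\<Sum>x\<in>UNIV. f g x * u x * v x)"
    unfolding lap_self_adjoint v by (simp add: sum_distrib_left mult_ac)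
  finally show ?thesis by (simp add: algebra_simps)
qed

text \<open>Completeness of the eigenbasis enters through \<open>parseval\<close>, which turns sums
  over \<open>j\<close> into sums over vertices.\<close>

lemma eigenvalue_gap_bound:
  fixes u :: "nat \<Rightarrow> 'v \<Rightarrow> real" and lam :: "nat \<Rightarrow> real"
  assumes mono: "mono_on {..<N} lam" and lam0: "lam 0 = 0"
    and \<mu>: "0 < \<mu>" "\<mu> \<le> 2" and c: "c > 0"
    and eig: "\<And>i x. i < N \<Longrightarrow> lap (u i) x = lam i * u i x"
    and unit: "\<And>i. i < N \<Longrightarrow> (\<Sum>x\<in>UNIV. (u i x)\<^sup>2) = 1"
    and parseval: "\<And>v w. (\<Sum>j<N. (\<Sum>x\<in>UNIV. v x * u j x) * (\<Sum>x\<in>UNIV. w x * u j x)) =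
      (\<Sum>x\<in>UNIV. v x * w x)"
    and k: "k + 1 < N"
  shows "lam (k + 1) \<le> (real (k + 1) * \<mu> + (\<Sum>i=1..k. (5 - 2 * \<mu>) * lam i - (lam i)\<^sup>2))
    / (\<Sum>i=0..k. 1 - lam i)"
proof -
  define b where "b = (\<lambda>g i j. \<Sum>x\<in>UNIV. f g x * u i x * u j x)"
  define \<beta> where "\<beta> = (\<lambda>i j. \<Sum>g\<in>I. (b g i j)\<^sup>2)"
  have coeff: "(lam j - lam i) * b g i j = (\<Sum>x\<in>UNIV. comm g (u i) x * u j x)"
    if "i < N" "j < N" for g i j
    unfolding b_def using comm_coefficient[OF eig[OF that(1)] eig[OF that(2)]] by simp
  show ?thesis
  proof (rule prefix_eigenvalue_inequality[OF mono lam0 \<mu>, of "c * \<mu>" \<beta>])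
    show "c * \<mu> > 0" using c \<mu> by simp
    show "\<beta> i j = \<beta> j i" for i j unfolding \<beta>_def b_def by (simp add: mult_ac)
    show "\<beta> i j \<ge> 0" for i j unfolding \<beta>_def by (simp add: sum_nonneg)
    show "k + 1 < N" by fact
    fix i assume i: "i < N"
    \<comment> \<open>One factor \<open>b g i j\<close> absorbs the gap and becomes a coefficient of
      \<open>comm\<close>; the other is a coefficient of the product of \<open>f g\<close> and
      \<open>u i\<close>.\<close>
    have "(\<Sum>j<N. (lam j - lam i) * \<beta> i j) =
        (\<Sum>g\<in>I. \<Sum>j<N. ((lam j - lam i) * b g i j) * b g i j)"
      unfolding \<beta>_def by (subst sum.swap) (simp add: sum_distrib_left power2_eq_square mult_ac)
    also have "\<dots> = (\<Sum>g\<in>I. \<Sum>x\<in>UNIV. comm g (u i) x * (f g x * u i x))"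
    proof (rule sum.cong[OF refl])
      fix g
      have "(\<Sum>j<N. ((lam j - lam i) * b g i j) * b g i j) =
          (\<Sum>j<N. (\<Sum>x\<in>UNIV. comm g (u i) x * u j x) * (\<Sum>x\<in>UNIV. (f g x * u i x) * u j x))"
        by (intro sum.cong refl) (simp only: lessThan_iff coeff[OF i], simp only: b_def)
      then show "(\<Sum>j<N. ((lam j - lam i) * b g i j) * b g i j) =
          (\<Sum>x\<in>UNIV. comm g (u i) x * (f g x * u i x))"
        by (simp only: parseval)
    qed
    also have "\<dots> = c * \<mu> * (1 - lam i)"
      by (rule sum_comm_inner[OF eig[OF i] unit[OF i]])
    finally show "(\<Sum>j<N. (lam j - lam i) * \<beta> i j) = c * \<mu> * (1 - lam i)" .
    \<comment> \<open>Here both factors absorb the gap, which produces the squared norm of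
      \<open>comm\<close>.\<close>
    have "(\<Sum>j<N. (lam j - lam i)\<^sup>2 * \<beta> i j) =
        (\<Sum>g\<in>I. \<Sum>j<N. ((lam j - lam i) * b g i j) * ((lam j - lam i) * b g i j))"
      unfolding \<beta>_def by (subst sum.swap) (simp add: sum_distrib_left power2_eq_square mult_ac)
    also have "\<dots> = (\<Sum>g\<in>I. \<Sum>x\<in>UNIV. (comm g (u i) x)\<^sup>2)"
    proof (rule sum.cong[OF refl])
      fix g
      have "(\<Sum>j<N. ((lam j - lam i) * b g i j) * ((lam j - lam i) * b g i j)) =
          (\<Sum>j<N. (\<Sum>x\<in>UNIV. comm g (u i) x * u j x) * (\<Sum>x\<in>UNIV. comm g (u i) x * u j x))"
        by (intro sum.cong refl) (simp only: lessThan_iff coeff[OF i])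
      then show "(\<Sum>j<N. ((lam j - lam i) * b g i j) * ((lam j - lam i) * b g i j)) =
          (\<Sum>x\<in>UNIV. (comm g (u i) x)\<^sup>2)"
        by (simp only: parseval power2_eq_square)
    qed
    also have "\<dots> \<le> c * \<mu> * (\<mu> + (4 - 2 * \<mu>) * lam i)"
      by (rule sum_comm_norm_le[OF eig[OF i] unit[OF i]])
    finally show "(\<Sum>j<N. (lam j - lam i)\<^sup>2 * \<beta> i j) \<le> c * \<mu> * (\<mu> + (4 - 2 * \<mu>) * lam i)" .
  qed
qed

end

section \<open>Eigenbases from multiplicities\<close>

text \<open>
  No spectral theorem is needed: the multiplicities already add up to the dimension of the whole
  space.
\<close>

lemma orthonormal_family_from_eigenspaces:
  fixes E :: "real \<Rightarrow> (real ^ 'v) set" and lam :: "nat \<Rightarrow> real"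
  assumes subspace: "\<And>\<mu>. subspace (E \<mu>)"
    and orth: "\<And>\<mu> \<nu> u v. \<mu> \<noteq> \<nu> \<Longrightarrow> u \<in> E \<mu> \<Longrightarrow> v \<in> E \<nu> \<Longrightarrow> u \<bullet> v = 0"
    and mult: "\<And>\<mu>. card {i. i < CARD('v) \<and> lam i = \<mu>} = dim (E \<mu>)"
  obtains b :: "nat \<Rightarrow> real ^ 'v" where
    "\<And>i. i < CARD('v) \<Longrightarrow> b i \<in> E (lam i)"
    "\<And>i. i < CARD('v) \<Longrightarrow> norm (b i) = 1"
    "\<And>v w. (\<Sum>j<CARD('v). (v \<bullet> b j) * (w \<bullet> b j)) = v \<bullet> w"
proof -
  let ?N = "CARD('v)"
  define S where "S \<mu> = {i. i < ?N \<and> lam i = \<mu>}" for \<mu>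
  \<comment> \<open>By \<open>mult\<close>, an orthonormal basis of \<open>E \<mu>\<close> can be
    indexed by the positions at which \<open>lam\<close> takes the value
    \<open>\<mu>\<close>.\<close>
  have "\<exists>h. inj_on h (S \<mu>) \<and> h ` S \<mu> \<subseteq> E \<mu> \<and> pairwise orthogonal (h ` S \<mu>) \<and>
      (\<forall>v \<in> h ` S \<mu>. norm v = 1)" for \<mu>
  proof -
    obtain B where B: "B \<subseteq> E \<mu>" "pairwise orthogonal B" "\<And>x. x \<in> B \<Longrightarrow> norm x = 1"
        "independent B" "card B = dim (E \<mu>)"
      using orthonormal_basis_subspace[OF subspace[of \<mu>]] by metis
    have "finite B" using B(4) by (rule independent_imp_finite)
    moreover have "finite (S \<mu>)" "card (S \<mu>) = card B"
      using B(5) mult[of \<mu>] by (simp_all add: S_def)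
    ultimately obtain h where "bij_betw h (S \<mu>) B"
      using finite_same_card_bij by blast
    then show ?thesis using B by (intro exI[of _ h]) (auto simp: bij_betw_def)
  qed
  then obtain h where "\<forall>\<mu>. inj_on (h \<mu>) (S \<mu>) \<and> h \<mu> ` S \<mu> \<subseteq> E \<mu> \<and>
      pairwise orthogonal (h \<mu> ` S \<mu>) \<and> (\<forall>v \<in> h \<mu> ` S \<mu>. norm v = 1)"
    by metis
  then have h: "inj_on (h \<mu>) (S \<mu>)" "h \<mu> ` S \<mu> \<subseteq> E \<mu>" "pairwise orthogonal (h \<mu> ` S \<mu>)"
      "v \<in> h \<mu> ` S \<mu> \<Longrightarrow> norm v = 1" for \<mu> v
    by blast+
  define b where "b i = h (lam i) i" for i
  have bE: "b i \<in> E (lam i)" if "i < ?N" for i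
    using h(2)[of "lam i"] that unfolding b_def S_def by auto
  have b1: "norm (b i) = 1" if "i < ?N" for i
    using h(4)[of "b i" "lam i"] that unfolding b_def S_def by auto
  have b0: "b i \<bullet> b j = 0" if "i < ?N" "j < ?N" "i \<noteq> j" for i j
  proof (cases "lam i = lam j")
    case True
    then have "b i \<noteq> b j"
      using inj_onD[OF h(1)[of "lam j"], of i j] that unfolding b_def S_def by auto
    moreover have "b i \<in> h (lam j) ` S (lam j)" "b j \<in> h (lam j) ` S (lam j)"
      using that True unfolding b_def S_def by auto
    ultimately show ?thesis
      using h(3)[of "lam j"] unfolding pairwise_def orthogonal_def by blast
  next
    case False
    then show ?thesis using orth bE that by blast
  qed
  have inj: "inj_on b {..<?N}"
  proof (rule inj_onI)
    fix i j assume "i \<in> {..<?N}" "j \<in> {..<?N}" "b i = b j"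
    then show "i = j" using b0[of i j] b1[of j] by (cases "i = j") auto
  qed
  have po: "pairwise orthogonal (b ` {..<?N})"
    using b0 by (auto simp: pairwise_def orthogonal_def)
  moreover have "0 \<notin> b ` {..<?N}" using b1 by force
  ultimately have "independent (b ` {..<?N})" by (rule pairwise_orthogonal_independent)
  \<comment> \<open>Independent vectors as many as the dimension fill the space.\<close>
  then have span: "UNIV \<subseteq> span (b ` {..<?N})"
    using inj by (intro card_ge_dim_independent) (auto simp: card_image)
  have "(\<Sum>j<?N. (v \<bullet> b j) * (w \<bullet> b j)) = v \<bullet> w" for v w
  proof -
    have "v = (\<Sum>i\<in>b ` {..<?N}. (v \<bullet> i) *\<^sub>R i)"
      by (rule orthonormal_basis_expand[OF po, symmetric]) (use b1 span in auto)
    also have "\<dots> = (\<Sum>j<?N. (v \<bullet> b j) *\<^sub>R b j)"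
      by (simp add: sum.reindex[OF inj])
    finally have "v \<bullet> w = (\<Sum>j<?N. (v \<bullet> b j) *\<^sub>R b j) \<bullet> w" by simp
    then show ?thesis by (simp add: inner_sum_right inner_commute[of _ w])
  qed
  with bE b1 show thesis by (rule that)
qed

section \<open>Symmetric graphs\<close>

locale connected_symmetric_graph = pair_graph G for G :: "'v::finite pair_pre_digraph" +
  assumes verts_UNIV: "pverts G = UNIV"
    and conn: "Digraph_Component.connected (with_proj G)"
    and edge_symmetric: "symmetric_graph G"
    and two_vertices: "CARD('v) \<ge> 2"
begin

abbreviation E :: "('v \<times> 'v) set" where "E \<equiv> parcs G"

abbreviation degree :: "'v \<Rightarrow> nat" where "degree \<equiv> out_degree (with_proj G)"

definition Aut :: "('v \<Rightarrow> 'v) set" where "Aut = {\<gamma>. graph_automorphism G \<gamma>}"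

lemma Aut_bij: "\<gamma> \<in> Aut \<Longrightarrow> bij \<gamma>"
  unfolding Aut_def graph_automorphism_def verts_UNIV by simp

lemma Aut_arc_iff: "\<gamma> \<in> Aut \<Longrightarrow> (\<gamma> x, \<gamma> y) \<in> E \<longleftrightarrow> (x, y) \<in> E"
  unfolding Aut_def graph_automorphism_def verts_UNIV by simp

lemma id_in_Aut: "id \<in> Aut"
  unfolding Aut_def graph_automorphism_def by simp

lemma comp_in_Aut: "\<gamma> \<in> Aut \<Longrightarrow> \<sigma> \<in> Aut \<Longrightarrow> \<gamma> \<circ> \<sigma> \<in> Aut"
  unfolding Aut_def graph_automorphism_def verts_UNIV by (auto intro: bij_betw_trans)

lemma edge_transitive:
  assumes "(x, y) \<in> E" "(x', y') \<in> E"
  obtains \<gamma> where "\<gamma> \<in> Aut" "\<gamma> x = x'" "\<gamma> y = y'"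
  using edge_symmetric assms unfolding symmetric_graph_def Aut_def by blast

lemma arc_sym: "(x, y) \<in> E \<longleftrightarrow> (y, x) \<in> E"
  using pair_sym_arcs by (auto simp: symmetric_def elim: symE)

lemma reachable_all: "x \<rightarrow>\<^sup>*\<^bsub>with_proj G\<^esub> y"
  using symmetric_connected_imp_strongly_connected[OF pair_sym_arcs conn]
  by (simp add: strongly_connected_def verts_UNIV)

text \<open>The witness comes from the first arc of a walk to another vertex.\<close>

lemma ex_arc: "\<exists>y. (x, y) \<in> E"
proof -
  have "UNIV \<noteq> {x}"
  proof
    assume "UNIV = {x}"
    then have "CARD('v) = card {x}" by (rule arg_cong)
    with two_vertices show False by simp
  qed
  then obtain z where "z \<noteq> x" by blast
  from reachable_all[of x z] show ?thesis
    by (cases rule: converse_reachable_cases) (use \<open>z \<noteq> x\<close> in auto)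
qed

text \<open>Every vertex is the tail of an arc, so transitivity on arcs applies.\<close>

lemma vertex_transitive:
  obtains \<gamma> where "\<gamma> \<in> Aut" "\<gamma> x = x'"
proof -
  obtain y y' where "(x, y) \<in> E" "(x', y') \<in> E" using ex_arc by blast
  then show thesis by (rule edge_transitive) (rule that)
qed

lemma degree_eq: "degree x = card {y. (x, y) \<in> E}"
proof -
  have "out_arcs (with_proj G) x = Pair x ` {y. (x, y) \<in> E}"
    by (auto simp: out_arcs_def)
  then show ?thesis
    unfolding out_degree_def by (simp add: card_image inj_on_def)
qed

lemma degree_pos: "degree x > 0"
  using ex_arc[of x] by (auto simp: degree_eq card_gt_0_iff)

lemma degree_Aut:
  assumes \<gamma>: "\<gamma> \<in> Aut"
  shows "degree (\<gamma> x) = degree x"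
proof -
  have "{y. (\<gamma> x, y) \<in> E} = \<gamma> ` {y. (x, y) \<in> E}"
  proof (intro equalityI subsetI)
    fix z assume z: "z \<in> {y. (\<gamma> x, y) \<in> E}"
    obtain y where "z = \<gamma> y" using bij_is_surj[OF Aut_bij[OF \<gamma>]] by (rule surjE)
    with z show "z \<in> \<gamma> ` {y. (x, y) \<in> E}" by (simp add: Aut_arc_iff[OF \<gamma>])
  qed (auto simp: Aut_arc_iff[OF \<gamma>])
  moreover have "inj \<gamma>" using Aut_bij[OF \<gamma>] by (rule bij_is_inj)
  ultimately show ?thesis by (simp add: degree_eq card_image inj_on_subset)
qed

lemma regular: "degree x = degree y"
proof -
  obtain \<gamma> where "\<gamma> \<in> Aut" "\<gamma> x = y" by (rule vertex_transitive)
  then show ?thesis using degree_Aut[of \<gamma> x] by simp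
qed

section \<open>The simple random walk and its invariance\<close>

definition walk_kernel :: "'v \<Rightarrow> 'v \<Rightarrow> real" where
  "walk_kernel x y = (if (x, y) \<in> E then 1 / real (degree x) else 0)"

sublocale symmetric_stochastic_kernel walk_kernel
proof
  show "walk_kernel x y = walk_kernel y x" for x y
    unfolding walk_kernel_def using arc_sym[of x y] regular[of x y] by simp
  show "walk_kernel x y \<ge> 0" for x y
    unfolding walk_kernel_def by simp
  show "(\<Sum>y\<in>UNIV. walk_kernel x y) = 1" for x
    unfolding walk_kernel_def using ex_arc[of x]
    by (simp add: sum.If_cases degree_eq)
qed

lemma walk_kernel_Aut: "\<gamma> \<in> Aut \<Longrightarrow> walk_kernel (\<gamma> x) (\<gamma> y) = walk_kernel x y"
  by (simp add: walk_kernel_def Aut_arc_iff degree_Aut)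

lemma lap_Aut:
  assumes \<gamma>: "\<gamma> \<in> Aut"
  shows "lap (\<lambda>x. u (\<gamma> x)) x = lap u (\<gamma> x)"
proof -
  have "lap u (\<gamma> x) = (\<Sum>y\<in>UNIV. walk_kernel (\<gamma> x) (\<gamma> y) * (u (\<gamma> x) - u (\<gamma> y)))"
    unfolding lap_def by (rule sum.reindex_bij_betw[symmetric]) (rule Aut_bij[OF \<gamma>])
  then show ?thesis by (simp add: lap_def walk_kernel_Aut[OF \<gamma>])
qed

text \<open>Right translation is an injective self-map of the finite set \<open>Aut\<close>, hence a
  permutation of the summands.\<close>

lemma sum_Aut_right_translate:
  fixes h :: "('v \<Rightarrow> 'v) \<Rightarrow> real"
  assumes \<sigma>: "\<sigma> \<in> Aut"
  shows "(\<Sum>\<gamma>\<in>Aut. h (\<gamma> \<circ> \<sigma>)) = (\<Sum>\<gamma>\<in>Aut. h \<gamma>)"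
proof -
  have inj: "inj_on (\<lambda>\<gamma>. \<gamma> \<circ> \<sigma>) Aut"
  proof (rule inj_onI)
    fix \<gamma> \<delta> assume "\<gamma> \<circ> \<sigma> = \<delta> \<circ> \<sigma>"
    then have eq: "\<gamma> (\<sigma> x) = \<delta> (\<sigma> x)" for x by (simp add: fun_eq_iff)
    show "\<gamma> = \<delta>"
    proof (rule ext)
      fix y
      obtain x where "y = \<sigma> x" using bij_is_surj[OF Aut_bij[OF \<sigma>]] by (rule surjE)
      then show "\<gamma> y = \<delta> y" by (simp add: eq)
    qed
  qed
  have image: "(\<lambda>\<gamma>. \<gamma> \<circ> \<sigma>) ` Aut = Aut"
    by (rule endo_inj_surj[OF _ _ inj]) (auto intro: comp_in_Aut[OF _ \<sigma>])
  show ?thesis using sum.reindex[OF inj, of h] unfolding image by simp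
qed

section \<open>Eigenspaces of the Laplacian\<close>

lemma mem_eigenspace_iff:
  "u \<in> laplacian_eigenspace G \<theta> \<longleftrightarrow> (\<forall>x. lap (($) u) x = \<theta> * u $ x)"
proof -
  have "normalized_laplacian G u $ x = - lap (($) u) x" for x
  proof -
    have "lap (($) u) x = (\<Sum>y | (x, y) \<in> E. 1 / real (degree x) * (u $ x - u $ y))"
      unfolding lap_def walk_kernel_def by (rule sum.mono_neutral_cong_right) auto
    then show ?thesis
      by (simp add: normalized_laplacian_def sum_distrib_left diff_divide_distrib
          flip: sum_negf)
  qed
  then show ?thesis
    by (auto simp: laplacian_eigenspace_def vec_eq_iff algebra_simps)
qed

lemma lap_linear:
  "lap (\<lambda>x. a * u x + b * v x) x = a * lap u x + b * lap v x"
  by (simp add: lap_def sum_distrib_left algebra_simps flip: sum.distrib)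

lemma subspace_eigenspace: "subspace (laplacian_eigenspace G \<theta>)"
proof (rule subspaceI)
  show "0 \<in> laplacian_eigenspace G \<theta>"
    by (simp add: mem_eigenspace_iff lap_def)
  show "u + v \<in> laplacian_eigenspace G \<theta>"
    if "u \<in> laplacian_eigenspace G \<theta>" "v \<in> laplacian_eigenspace G \<theta>" for u v
  proof -
    have "($) (u + v) = (\<lambda>x. 1 * u $ x + 1 * v $ x)" by (simp add: fun_eq_iff)
    with that show ?thesis by (simp only: mem_eigenspace_iff lap_linear) (simp add: algebra_simps)
  qed
  show "a *\<^sub>R u \<in> laplacian_eigenspace G \<theta>"
    if "u \<in> laplacian_eigenspace G \<theta>" for a u
  proof -
    have "($) (a *\<^sub>R u) = (\<lambda>x. a * u $ x + 0 * u $ x)" by (simp add: fun_eq_iff)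
    with that show ?thesis by (simp only: mem_eigenspace_iff lap_linear) simp
  qed
qed

text \<open>Self-adjointness evaluates the pairing of \<open>lap u\<close> with \<open>v\<close>
  both as \<theta> and as \<nu> times \<open>u \<bullet> v\<close>.\<close>

lemma eigenspaces_orthogonal:
  assumes "\<theta> \<noteq> \<nu>" "u \<in> laplacian_eigenspace G \<theta>" "v \<in> laplacian_eigenspace G \<nu>"
  shows "u \<bullet> v = 0"
proof -
  have "\<theta> * (u \<bullet> v) = (\<Sum>x\<in>UNIV. lap (($) u) x * v $ x)"
    using assms(2) by (simp add: mem_eigenspace_iff inner_vec_def sum_distrib_left mult_ac)
  also have "\<dots> = \<nu> * (u \<bullet> v)"
    unfolding lap_self_adjoint using assms(3)
    by (simp add: mem_eigenspace_iff inner_vec_def sum_distrib_left mult_ac)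
  finally show ?thesis using assms(1) by simp
qed

text \<open>A vanishing Dirichlet form makes \<open>u\<close> constant along arcs and, by
  connectedness, everywhere. Thus 0 is a simple eigenvalue.\<close>

lemma eigenspace_zero: "laplacian_eigenspace G 0 = span {\<chi> x. 1}"
proof
  have "(\<chi> x. 1) \<in> laplacian_eigenspace G 0"
    by (simp add: mem_eigenspace_iff lap_def)
  then show "span {\<chi> x. 1} \<subseteq> laplacian_eigenspace G 0"
    by (intro span_minimal subspace_eigenspace) simp
  show "laplacian_eigenspace G 0 \<subseteq> span {\<chi> x. 1}"
  proof
    fix u assume "u \<in> laplacian_eigenspace G 0"
    then have "(\<Sum>x\<in>UNIV. \<Sum>y\<in>UNIV. walk_kernel x y * (u $ x - u $ y)\<^sup>2) = 0"
      by (simp add: dirichlet_form mem_eigenspace_iff)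
    then have zero: "walk_kernel x y * (u $ x - u $ y)\<^sup>2 = 0" for x y
      by (simp add: sum_nonneg_eq_0_iff sum_nonneg nonneg del: mult_eq_0_iff)
    have step: "u $ x = u $ y" if "(x, y) \<in> E" for x y
      using zero[of x y] that degree_pos[of x] by (simp add: walk_kernel_def)
    have "u $ x = u $ y" for x y
      using reachable_all[of x y] by (induction rule: reachable_induct) (auto simp: step)
    then have "u = u $ undefined *\<^sub>R (\<chi> x. 1)" by (simp add: vec_eq_iff)
    then show "u \<in> span {\<chi> x. 1}" by (auto simp: span_singleton)
  qed
qed

section \<open>Translates of an eigenfunction and the eigenvalue bound\<close>

text \<open>Transitivity makes the sum of squares independent of the vertex and the correlation
  along an arc independent of its head; the eigenvalue equation then determines the correlation.
  \<open>undefined\<close> serves as an arbitrary base vertex.\<close>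

lemma spherical_translates:
  fixes f :: "'v \<Rightarrow> real"
  assumes eig: "\<And>x. lap f x = \<theta> * f x"
  shows "spherical_eigenfunctions walk_kernel Aut (\<lambda>\<gamma> x. f (\<gamma> x)) \<theta>
    (\<Sum>\<gamma>\<in>Aut. (f (\<gamma> undefined))\<^sup>2)"
proof
  show eig': "lap (\<lambda>x. f (\<gamma> x)) x = \<theta> * f (\<gamma> x)" if "\<gamma> \<in> Aut" for \<gamma> x
    by (simp add: lap_Aut[OF that] eig)
  show sq: "(\<Sum>\<gamma>\<in>Aut. (f (\<gamma> x))\<^sup>2) = (\<Sum>\<gamma>\<in>Aut. (f (\<gamma> undefined))\<^sup>2)" for x
  proof -
    obtain \<sigma> where "\<sigma> \<in> Aut" "\<sigma> undefined = x" by (rule vertex_transitive)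
    then show ?thesis using sum_Aut_right_translate[of \<sigma> "\<lambda>\<gamma>. (f (\<gamma> undefined))\<^sup>2"] by simp
  qed
  fix x y assume "walk_kernel x y \<noteq> 0"
  then have xy: "(x, y) \<in> E" by (auto simp: walk_kernel_def split: if_splits)
  have const: "walk_kernel x z * (\<Sum>\<gamma>\<in>Aut. f (\<gamma> x) * f (\<gamma> z)) =
      walk_kernel x z * (\<Sum>\<gamma>\<in>Aut. f (\<gamma> x) * f (\<gamma> y))" for z
  proof (cases "(x, z) \<in> E")
    case True
    with xy obtain \<sigma> where "\<sigma> \<in> Aut" "\<sigma> x = x" "\<sigma> y = z" by (rule edge_transitive)
    then show ?thesis using sum_Aut_right_translate[of \<sigma> "\<lambda>\<gamma>. f (\<gamma> x) * f (\<gamma> y)"] by simp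
  qed (simp add: walk_kernel_def)
  \<comment> \<open>Since all neighbours give the same correlation, one neighbour may be replaced by
    the average over all of them.\<close>
  have "(\<Sum>\<gamma>\<in>Aut. f (\<gamma> x) * f (\<gamma> y)) =
      (\<Sum>z\<in>UNIV. walk_kernel x z * (\<Sum>\<gamma>\<in>Aut. f (\<gamma> x) * f (\<gamma> y)))"
    by (simp add: sum_one flip: sum_distrib_right)
  also have "\<dots> = (\<Sum>\<gamma>\<in>Aut. f (\<gamma> x) * (\<Sum>z\<in>UNIV. walk_kernel x z * f (\<gamma> z)))"
    unfolding const[symmetric] unfolding sum_distrib_left by (subst sum.swap) (simp add: mult_ac)
  also have "\<dots> = (\<Sum>\<gamma>\<in>Aut. (f (\<gamma> x))\<^sup>2 * (1 - \<theta>))"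
  proof (rule sum.cong[OF refl])
    fix \<gamma> assume "\<gamma> \<in> Aut"
    from eig'[OF this, of x] have "(\<Sum>z\<in>UNIV. walk_kernel x z * f (\<gamma> z)) = (1 - \<theta>) * f (\<gamma> x)"
      by (simp add: lap_alt algebra_simps)
    then show "f (\<gamma> x) * (\<Sum>z\<in>UNIV. walk_kernel x z * f (\<gamma> z)) = (f (\<gamma> x))\<^sup>2 * (1 - \<theta>)"
      by (simp add: power2_eq_square)
  qed
  finally show "(\<Sum>\<gamma>\<in>Aut. f (\<gamma> x) * f (\<gamma> y)) = (\<Sum>\<gamma>\<in>Aut. (f (\<gamma> undefined))\<^sup>2) * (1 - \<theta>)"
    by (simp only: sq[of x] flip: sum_distrib_right)
qed

lemma eigenvalue_inequality:
  assumes lam: "laplacian_eigenvalues G lam" and k: "k + 1 < CARD('v)"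
  shows "lam (k + 1) \<le>
    (real (k + 1) * lam 1 + (\<Sum>i=1..k. (5 - 2 * lam 1) * lam i - (lam i)\<^sup>2))
      / (\<Sum>i=0..k. 1 - lam i)"
proof -
  let ?N = "CARD('v)"
  have mono: "mono_on {..<?N} lam"
    and mult: "\<And>\<theta>. card {i. i < ?N \<and> lam i = \<theta>} = dim (laplacian_eigenspace G \<theta>)"
    using lam by (simp_all add: laplacian_eigenvalues_def verts_UNIV)
  obtain b where bE: "\<And>i. i < ?N \<Longrightarrow> b i \<in> laplacian_eigenspace G (lam i)"
    and b1: "\<And>i. i < ?N \<Longrightarrow> norm (b i) = 1"
    and parseval: "\<And>v w. (\<Sum>j<?N. (v \<bullet> b j) * (w \<bullet> b j)) = v \<bullet> w"
    by (rule orthonormal_family_from_eigenspaces[of "laplacian_eigenspace G" lam])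
      (rule subspace_eigenspace, erule (2) eigenspaces_orthogonal, rule mult, rule that)
  have eig: "lap (($) (b i)) x = lam i * b i $ x" if "i < ?N" for i x
    using bE[OF that] by (simp add: mem_eigenspace_iff)
  have unit: "(\<Sum>x\<in>UNIV. (b i $ x)\<^sup>2) = 1" if "i < ?N" for i
    using b1[OF that] by (simp add: norm_eq_1 inner_vec_def power2_eq_square)
  have bounds: "0 \<le> lam i" "lam i \<le> 2" if "i < ?N" for i
    using eigenvalue_bounds[of "($) (b i)" "lam i"] eig unit that by simp_all
  have le: "lam i \<le> lam j" if "i \<le> j" "j < ?N" for i j
    using mono_onD[OF mono, of i j] that by simp
  \<comment> \<open>Exactly one index carries the value 0. Monotonicity and nonnegativity make it
    index 0, so \<open>lam 1\<close> is nonzero.\<close>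
  have "dim (laplacian_eigenspace G 0) = 1"
    by (simp add: eigenspace_zero dim_span dim_insert vec_eq_iff)
  then have one: "card {i. i < ?N \<and> lam i = 0} = 1" using mult by simp
  then have "{i. i < ?N \<and> lam i = 0} \<noteq> {}" by (metis card.empty zero_neq_one)
  then obtain i where "i < ?N" "lam i = 0" by blast
  then have lam0: "lam 0 = 0" using le[of 0 i] bounds(1)[of 0] by simp
  have lam1: "lam 1 \<noteq> 0"
  proof
    assume "lam 1 = 0"
    then have "{0, 1} \<subseteq> {i. i < ?N \<and> lam i = 0}" using lam0 two_vertices by auto
    then have "card {0, 1 :: nat} \<le> 1" unfolding one[symmetric] by (intro card_mono) auto
    then show False by simp
  qed
  define c where "c = (\<Sum>\<gamma>\<in>Aut. (b 1 $ \<gamma> undefined)\<^sup>2)"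
  interpret spherical_eigenfunctions walk_kernel Aut "\<lambda>\<gamma> x. b 1 $ \<gamma> x" "lam 1" c
    unfolding c_def using eig two_vertices by (intro spherical_translates) simp
  \<comment> \<open>The identity contributes the summand \<open>(b 1 $ x)\<^sup>2\<close>, and
    \<open>sum_sq\<close> lets \<open>x\<close> be a vertex where \<open>b 1\<close> is
    nonzero.\<close>
  have c: "c > 0"
  proof -
    have "(b 1 $ x)\<^sup>2 \<le> c" for x
      using member_le_sum[of id Aut "\<lambda>\<gamma>. (b 1 $ \<gamma> x)\<^sup>2"] id_in_Aut unfolding sum_sq by simp
    moreover have "b 1 \<noteq> 0" using b1[of 1] two_vertices by auto
    then obtain x where "b 1 $ x \<noteq> 0" by (auto simp: vec_eq_iff)
    then have "(b 1 $ x)\<^sup>2 > 0" by simp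
    ultimately show ?thesis by (rule less_le_trans[rotated])
  qed
  have lam1_bounds: "lam 1 > 0" "lam 1 \<le> 2"
    using bounds[of 1] lam1 two_vertices by auto
  have parseval': "(\<Sum>j<?N. (\<Sum>x\<in>UNIV. v x * b j $ x) * (\<Sum>x\<in>UNIV. w x * b j $ x)) =
      (\<Sum>x\<in>UNIV. v x * w x)" for v w
    using parseval[of "\<chi> x. v x" "\<chi> x. w x"] by (simp add: inner_vec_def)
  show ?thesis
    by (rule eigenvalue_gap_bound[OF mono lam0 lam1_bounds c eig unit parseval' k])
qed

end

theorem theorem1p2:
  fixes G :: "'v::finite pair_pre_digraph"
    and lam :: "nat \<Rightarrow> real"
    and N k :: nat
  assumes "pverts G = UNIV"
    and "pair_graph G"
    and "Digraph_Component.connected (with_proj G)"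
    and "symmetric_graph G"
    and "N = card (pverts G)"
    and "N \<ge> 2"
    and "laplacian_eigenvalues G lam"
    and "k \<le> N - 2"
  shows "lam (k + 1) \<le>
    (real (k + 1) * lam 1 + (\<Sum>i=1..k. (5 - 2 * lam 1) * lam i - (lam i)\<^sup>2))
      / (\<Sum>i=0..k. 1 - lam i)"
proof -
  interpret connected_symmetric_graph G
    using assms by (auto simp: connected_symmetric_graph_def connected_symmetric_graph_axioms_def)
  \<comment> \<open>Natural subtraction does not truncate: \<open>N \<ge> 2\<close> and
    \<open>k \<le> N - 2\<close> give \<open>k + 1 < N\<close>.\<close>
  show ?thesis
    using assms by (intro eigenvalue_inequality) auto
qed

end
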